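(* Let $N, n, m \geq 1$ be integers, let $\mathcal M = \{A_1, \dotsc, A_N\}$ be an indexed family of real $n\times n$ matrices, and let $\mathcal W = \{W_1, \dotsc, W_N\}$ be an indexed family of real $m\times m$ matrices. Let \[ \lambda_{\mathcal W}(\mathcal M) = \rho\left(\frac{1}{N}\sum_{i=1}^N W_i\otimes A_i\right). \] If $\rho_\infty(\mathcal W) = 1$, then $\lambda_{\mathcal W}(\mathcal M) \leq \rho_1(\mathcal M)$.
   Context: Notation: $\lVert \cdot\rVert$ denotes the maximum singular value of a matrix, $\rho(\cdot)$ the spectral radius of a square matrix, and $\otimes$ the Kronecker product. The $1$-radius of an indexed family $\mathcal M = \{A_1,\dotsc,A_N\}$ of square matrices of the same size (repetitions allowed) is \[ \rho_1(\mathcal M) = \lim_{k\to\infty}\left(\frac{1}{N^k}\sum_{i_1,\dotsc,i_k=1}^N \lVert A_{i_k}\dotsm A_{i_1}\rVert\right)^{1/k} \] (the limit exists). The joint spectral radius of an indexed family $\mathcal W=\{W_1,\dotsc,W_N\}$ of square matrices of the same size is \[ \rho_\infty(\mathcal W) = \limsup_{k\to\infty}\ \max_{i_1,\dotsc,i_k\in\{1,\dotsc,N\}} \lVert W_{i_k}\dotsm W_{i_1}\rVert^{1/k}. \] *)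

theory Defs
  imports "HOL-Library.Liminf_Limsup" "HOL-Library.Extended_Real"
    "Jordan_Normal_Form.Spectral_Radius"
begin

text \<open>The singular values of \<open>A\<close> are the square roots of the eigenvalues of \<open>A\<^sup>T A\<close>. For real \<open>A\<close>
  all of these eigenvalues are real and nonnegative, so the real spectrum is the whole spectrum;
  it is nonempty as soon as \<open>A\<close> has at least one column.\<close>

definition singular_values :: "real mat \<Rightarrow> real set" where
  "singular_values A = sqrt ` spectrum (transpose_mat A * A)"

definition max_singular_value :: "real mat \<Rightarrow> real" where
  "max_singular_value A = Max (singular_values A)"

definition kronecker :: "'a :: times mat \<Rightarrow> 'a mat \<Rightarrow> 'a mat" (infixl "\<otimes>\<^sub>K" 70) where
  "W \<otimes>\<^sub>K A = mat (dim_row W * dim_row A) (dim_col W * dim_col A)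
     (\<lambda>(i, j). W $$ (i div dim_row A, j div dim_col A) * A $$ (i mod dim_row A, j mod dim_col A))"

definition index_words :: "nat \<Rightarrow> nat \<Rightarrow> nat list set" where
  "index_words N k = {w. length w = k \<and> set w \<subseteq> {1..N}}"

text \<open>The head of the word is the rightmost factor: the word \<open>[i\<^sub>1, \<dots>, i\<^sub>k]\<close> yields
  \<open>A i\<^sub>k * \<dots> * A i\<^sub>1\<close>.\<close>

primrec word_product :: "nat \<Rightarrow> (nat \<Rightarrow> real mat) \<Rightarrow> nat list \<Rightarrow> real mat" where
  "word_product d A [] = 1\<^sub>m d"
| "word_product d A (i # w) = word_product d A w * A i"

text \<open>In all of the following, a family of \<open>N\<close> matrices of size \<open>d \<times> d\<close> is a function on the
  indices \<open>1, \<dots>, N\<close>; its values at other indices are never used. The term for \<open>k = 0\<close>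
  in the two sequences below is \<open>root 0 _ = 0\<close> and does not influence the limits.\<close>

definition one_radius :: "nat \<Rightarrow> nat \<Rightarrow> (nat \<Rightarrow> real mat) \<Rightarrow> real" where
  "one_radius N d A = lim (\<lambda>k. root k
     (1 / real N ^ k * (\<Sum>w\<in>index_words N k. max_singular_value (word_product d A w))))"

definition joint_spectral_radius :: "nat \<Rightarrow> nat \<Rightarrow> (nat \<Rightarrow> real mat) \<Rightarrow> ereal" where
  "joint_spectral_radius N d W = limsup (\<lambda>k. ereal
     (Max ((\<lambda>w. root k (max_singular_value (word_product d W w))) ` index_words N k)))"

text \<open>The matrix sum is the one of the additive structure of \<open>module_mat\<close>, since matrices of
  unspecified dimension have no zero element.\<close>

definition kronecker_mean ::
    "nat \<Rightarrow> nat \<Rightarrow> nat \<Rightarrow> (nat \<Rightarrow> real mat) \<Rightarrow> (nat \<Rightarrow> real mat) \<Rightarrow> real mat" where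
  "kronecker_mean N m n W A = (1 / real N) \<cdot>\<^sub>m
     finsum (module_mat TYPE(real) (m * n) (m * n)) (\<lambda>i. W i \<otimes>\<^sub>K A i) {1..N}"

definition kronecker_radius ::
    "nat \<Rightarrow> nat \<Rightarrow> nat \<Rightarrow> (nat \<Rightarrow> real mat) \<Rightarrow> (nat \<Rightarrow> real mat) \<Rightarrow> real" where
  "kronecker_radius N m n W A =
     spectral_radius (map_mat complex_of_real (kronecker_mean N m n W A))"

end

theory Submission
  imports Defs "Jordan_Normal_Form.Schur_Decomposition"
begin

text \<open>If \<open>z\<close> is an eigenvalue of maximal modulus of the mean of the \<open>W\<^sub>i \<otimes> A\<^sub>i\<close>, with eigenvector
  \<open>v\<close>, then the mixed-product rule gives \<open>N\<^sup>k z\<^sup>k v = (\<Sum>\<^sub>w W\<^sub>w \<otimes> A\<^sub>w) v\<close>, the sum being over all words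
  \<open>w\<close> of length \<open>k\<close>. Matrix entries are bounded by a constant times the norm, so
  \<open>\<bar>z\<bar>\<^sup>k \<le> C \<cdot> max\<^sub>w \<parallel>W\<^sub>w\<parallel> \<cdot> N\<^sup>-\<^sup>k \<Sum>\<^sub>w \<parallel>A\<^sub>w\<parallel>\<close>. Taking \<open>k\<close>-th roots, the constant disappears, the maximum
  contributes at most the joint spectral radius \<open>1\<close>, and the mean converges to the \<open>1\<close>-radius.

  Since constants are harmless, it is enough to know that the largest singular value is equivalent
  to the Frobenius norm. This follows from the trace of \<open>X\<^sup>T X\<close>, which is both the squared Frobenius
  norm and the sum of the squared singular values.\<close>

section \<open>Matrix entries as sums, and the trace\<close>

lemma index_mult_mat_sum:
  assumes "X \<in> carrier_mat a b" "Y \<in> carrier_mat b c" "i < a" "j < c"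
  shows "(X * Y) $$ (i, j) = (\<Sum>k<b. X $$ (i, k) * Y $$ (k, j))"
  using assms by (auto simp: scalar_prod_def atLeast0LessThan intro!: sum.cong)

lemma index_mult_mat_vec_sum:
  assumes "X \<in> carrier_mat a b" "v \<in> carrier_vec b" "i < a"
  shows "(X *\<^sub>v v) $ i = (\<Sum>k<b. X $$ (i, k) * v $ k)"
  using assms by (auto simp: scalar_prod_def atLeast0LessThan intro!: sum.cong)

lemma sum_diag_mult_commute:
  fixes X Y :: "'a :: comm_semiring_0 mat"
  assumes "X \<in> carrier_mat a b" "Y \<in> carrier_mat b a"
  shows "(\<Sum>i<a. (X * Y) $$ (i, i)) = (\<Sum>i<b. (Y * X) $$ (i, i))"
proof -
  have "(\<Sum>i<a. (X * Y) $$ (i, i)) = (\<Sum>i<a. \<Sum>k<b. X $$ (i, k) * Y $$ (k, i))"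
    using index_mult_mat_sum[OF assms] by (intro sum.cong) auto
  also have "\<dots> = (\<Sum>k<b. \<Sum>i<a. X $$ (i, k) * Y $$ (k, i))"
    by (rule sum.swap)
  also have "\<dots> = (\<Sum>k<b. (Y * X) $$ (k, k))"
    using index_mult_mat_sum[OF assms(2,1)] by (intro sum.cong) (auto simp: mult.commute)
  finally show ?thesis .
qed

text \<open>A Schur decomposition \<open>B = P * T * Q\<close> with \<open>Q * P\<close> the
  identity puts \<open>es\<close> on the diagonal of \<open>T\<close>; cyclicity of the trace moves
  \<open>Q\<close> to the front, where it cancels \<open>P\<close>. Working with the list
  \<open>es\<close> keeps multiplicities.\<close>

lemma sum_diag_eq_sum_list_eigenvalues:
  fixes B :: "complex mat"
  assumes B: "B \<in> carrier_mat n n" and cp: "char_poly B = (\<Prod>e\<leftarrow>es. [:- e, 1:])"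
  shows "(\<Sum>i<n. B $$ (i, i)) = sum_list es"
proof -
  obtain T P Q where sd: "schur_decomposition B es = (T, P, Q)"
    by (cases "schur_decomposition B es")
  from schur_decomposition[OF B cp sd] have wit: "similar_mat_wit B T P Q" and diag: "diag_mat T = es"
    by auto
  note w = similar_mat_witD2[OF B wit]
  have "(\<Sum>i<n. B $$ (i, i)) = (\<Sum>i<n. ((P * T) * Q) $$ (i, i))"
    using w(3) by simp
  also have "\<dots> = (\<Sum>i<n. (Q * (P * T)) $$ (i, i))"
    using w by (intro sum_diag_mult_commute) auto
  also have "Q * (P * T) = T"
  proof -
    have "Q * (P * T) = (Q * P) * T" using w by (intro assoc_mult_mat[symmetric]) auto
    thus ?thesis using w by simp
  qed
  also have "(\<Sum>i<n. T $$ (i, i)) = sum_list (diag_mat T)"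
    using w unfolding diag_mat_def by (simp add: interv_sum_list_conv_sum_set_nat atLeast0LessThan)
  finally show ?thesis by (simp add: diag)
qed

section \<open>The largest singular value compared with the Frobenius norm\<close>

lemma index_gram_mat:
  fixes X :: "'a :: comm_semiring_0 mat"
  assumes "X \<in> carrier_mat p n" "i < n" "j < n"
  shows "(transpose_mat X * X) $$ (i, j) = (\<Sum>r<p. X $$ (r, i) * X $$ (r, j))"
proof -
  have "(transpose_mat X * X) $$ (i, j) = (\<Sum>r<p. transpose_mat X $$ (i, r) * X $$ (r, j))"
    using assms by (intro index_mult_mat_sum) auto
  also have "\<dots> = (\<Sum>r<p. X $$ (r, i) * X $$ (r, j))"
    using assms by (intro sum.cong) auto
  finally show ?thesis .
qed

text \<open>Pairing the eigenvector equation with the conjugate of \<open>v\<close> gives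
  \<open>z * S = T\<close>, where \<open>S\<close> is the squared length of \<open>v\<close> and
  \<open>T\<close> that of \<open>X v\<close>. The trace is the sum of the complex eigenvalues,
  while \<open>singular_values\<close> uses only the real spectrum; this lemma bridges the
  two.\<close>

lemma gram_mat_eigenvalue_real_nonneg:
  fixes X :: "real mat"
  assumes X: "X \<in> carrier_mat p n"
    and ev: "eigenvalue (map_mat complex_of_real (transpose_mat X * X)) z"
  obtains x where "z = complex_of_real x" "0 \<le> x" "x \<in> spectrum (transpose_mat X * X)"
proof -
  define B where "B = transpose_mat X * X"
  have B: "B \<in> carrier_mat n n" and CB: "map_mat complex_of_real B \<in> carrier_mat n n"
    using X by (auto simp: B_def)
  from ev obtain v where v: "v \<in> carrier_vec n" "v \<noteq> 0\<^sub>v n"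
      "map_mat complex_of_real B *\<^sub>v v = z \<cdot>\<^sub>v v"
    using CB by (auto simp: eigenvalue_def eigenvector_def B_def[symmetric])
  define S where "S = (\<Sum>j<n. (cmod (v $ j))\<^sup>2)"
  define T where "T = (\<Sum>r<p. (cmod (\<Sum>c<n. complex_of_real (X $$ (r, c)) * v $ c))\<^sup>2)"
  have row: "(\<Sum>c<n. complex_of_real (B $$ (j, c)) * v $ c) = z * v $ j" if "j < n" for j
  proof -
    have "(map_mat complex_of_real B *\<^sub>v v) $ j = (\<Sum>c<n. map_mat complex_of_real B $$ (j, c) * v $ c)"
      using CB v that by (intro index_mult_mat_vec_sum) auto
    also have "\<dots> = (\<Sum>c<n. complex_of_real (B $$ (j, c)) * v $ c)"
      using B that by (intro sum.cong) auto
    finally show ?thesis using v that by simp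
  qed
  have "z * complex_of_real S = (\<Sum>j<n. cnj (v $ j) * (z * v $ j))"
    unfolding S_def of_real_sum sum_distrib_left
    by (intro sum.cong) (auto simp: complex_norm_square mult_ac simp del: of_real_power)
  also have "\<dots> = (\<Sum>j<n. cnj (v $ j) * (\<Sum>c<n. complex_of_real (B $$ (j, c)) * v $ c))"
    by (intro sum.cong) (auto simp: row)
  also have "\<dots> = (\<Sum>j<n. \<Sum>c<n. \<Sum>r<p. cnj (of_real (X $$ (r, j)) * v $ j) * (of_real (X $$ (r, c)) * v $ c))"
    unfolding sum_distrib_left
    by (intro sum.cong) (auto simp: B_def index_gram_mat[OF X] sum_distrib_left sum_distrib_right mult_ac
        simp del: index_mult_mat)
  also have "\<dots> = (\<Sum>j<n. \<Sum>r<p. \<Sum>c<n. cnj (of_real (X $$ (r, j)) * v $ j) * (of_real (X $$ (r, c)) * v $ c))"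
    by (intro sum.cong refl sum.swap)
  also have "\<dots> = (\<Sum>r<p. \<Sum>j<n. \<Sum>c<n. cnj (of_real (X $$ (r, j)) * v $ j) * (of_real (X $$ (r, c)) * v $ c))"
    by (rule sum.swap)
  also have "\<dots> = (\<Sum>r<p. cnj (\<Sum>c<n. of_real (X $$ (r, c)) * v $ c) * (\<Sum>c<n. of_real (X $$ (r, c)) * v $ c))"
    unfolding cnj_sum sum_product by simp
  also have "\<dots> = of_real T"
    unfolding T_def of_real_sum
    by (intro sum.cong) (auto simp: complex_norm_square mult_ac simp del: of_real_power)
  finally have zST: "z * of_real S = of_real T" .
  from v obtain j where "j < n" "v $ j \<noteq> 0" by (metis carrier_vecD eq_vecI index_zero_vec)
  hence "0 < (cmod (v $ j))\<^sup>2" "(cmod (v $ j))\<^sup>2 \<le> S"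
    unfolding S_def by (auto intro!: member_le_sum)
  hence S: "S > 0" by linarith
  have T: "T \<ge> 0" unfolding T_def by (intro sum_nonneg) auto
  have z: "z = of_real (T / S)" using zST S by (simp add: field_simps)
  \<comment> \<open>Forming the characteristic polynomial commutes with the embedding of the reals,
    so the real number \<open>T / S\<close> is already a root over the reals.\<close>
  have "poly (char_poly (map_mat complex_of_real B)) z = 0"
    using ev CB by (simp add: B_def[symmetric] eigenvalue_root_char_poly)
  hence "poly (char_poly B) (T / S) = 0"
    unfolding of_real_hom.char_poly_hom[OF B] z of_real_hom.poly_map_poly of_real_eq_0_iff .
  hence "T / S \<in> spectrum B" using spectrum_root_char_poly[OF B] by auto
  with z S T show ?thesis by (intro that[of "T / S"]) (auto simp: B_def)
qed

text \<open>Both comparisons are about a list \<open>xs\<close> of \<open>n\<close> nonnegative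
  numbers, the eigenvalues of \<open>X^T X\<close>: the largest is at most their sum, and their sum
  is at most \<open>n\<close> times the largest. With \<open>n\<close> at least 1 the maximum in
  \<open>max_singular_value\<close> is taken over a nonempty set.\<close>

lemma
  fixes X :: "real mat"
  assumes X: "X \<in> carrier_mat p n" and n: "n \<ge> 1"
  shows max_singular_value_nonneg: "0 \<le> max_singular_value X"
    and max_singular_value_sq_le: "(max_singular_value X)\<^sup>2 \<le> (\<Sum>j<n. \<Sum>i<p. (X $$ (i, j))\<^sup>2)"
    and sum_sq_le_max_singular_value: "(\<Sum>j<n. \<Sum>i<p. (X $$ (i, j))\<^sup>2) \<le> real n * (max_singular_value X)\<^sup>2"
proof -
  define B where "B = transpose_mat X * X"
  have B: "B \<in> carrier_mat n n" and CB: "map_mat complex_of_real B \<in> carrier_mat n n"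
    using X by (auto simp: B_def)
  from char_poly_factorized[OF CB] obtain es where
    cp: "char_poly (map_mat complex_of_real B) = (\<Prod>e\<leftarrow>es. [:- e, 1:])" and len: "length es = n" by auto
  have root: "poly (char_poly (map_mat complex_of_real B)) z = 0 \<longleftrightarrow> z \<in> set es" for z
    unfolding cp poly_prod_list prod_list_zero_iff by auto
  have es: "\<exists>x. z = complex_of_real x \<and> 0 \<le> x \<and> x \<in> spectrum B" if "z \<in> set es" for z
    using gram_mat_eigenvalue_real_nonneg[OF X, of z] that root
    by (metis B_def CB eigenvalue_root_char_poly)
  \<comment> \<open>A list rather than the spectrum, because the trace counts eigenvalues with
    multiplicity; only its set of elements is identified with \<open>spectrum B\<close>.\<close>
  define xs where "xs = map Re es"
  have es_xs: "es = map complex_of_real xs"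
    unfolding xs_def map_map by (intro map_idI[symmetric]) (use es in force)
  have set_xs: "set xs = spectrum B"
  proof
    show "set xs \<subseteq> spectrum B" unfolding xs_def using es by force
    show "spectrum B \<subseteq> set xs"
    proof
      fix x assume "x \<in> spectrum B"
      hence "poly (char_poly B) x = 0" using spectrum_root_char_poly[OF B] by auto
      hence "complex_of_real x \<in> set es"
        unfolding root[symmetric] of_real_hom.char_poly_hom[OF B] of_real_hom.poly_map_poly by simp
      thus "x \<in> set xs" unfolding es_xs by auto
    qed
  qed
  have nonneg: "0 \<le> x" if "x \<in> set xs" for x using that es unfolding xs_def by force
  have "complex_of_real (sum_list xs) = sum_list es" unfolding es_xs by (induction xs) auto
  also have "\<dots> = (\<Sum>i<n. map_mat complex_of_real B $$ (i, i))"
    by (rule sum_diag_eq_sum_list_eigenvalues[OF CB cp, symmetric])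
  also have "\<dots> = complex_of_real (\<Sum>j<n. \<Sum>i<p. (X $$ (i, j))\<^sup>2)"
    unfolding of_real_sum[of _ "{..<n}"] using B
    by (intro sum.cong) (auto simp: B_def index_gram_mat[OF X] power2_eq_square simp del: index_mult_mat(1))
  finally have tr: "(\<Sum>j<n. \<Sum>i<p. (X $$ (i, j))\<^sup>2) = sum_list xs" by (metis of_real_eq_iff)
  have fin: "finite (singular_values X)" and ne: "singular_values X \<noteq> {}"
    using set_xs n len by (auto simp: singular_values_def B_def[symmetric] xs_def)
      (metis finite_imageI List.finite_set)
  have "max_singular_value X \<in> singular_values X"
    unfolding max_singular_value_def by (rule Max_in[OF fin ne])
  then obtain x where x: "x \<in> set xs" "max_singular_value X = sqrt x"
    using set_xs by (auto simp: singular_values_def B_def[symmetric])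
  show "0 \<le> max_singular_value X" using x nonneg by auto
  have sq: "(max_singular_value X)\<^sup>2 = x" using x nonneg by auto
  show "(max_singular_value X)\<^sup>2 \<le> (\<Sum>j<n. \<Sum>i<p. (X $$ (i, j))\<^sup>2)"
    unfolding sq tr using member_le_sum_list[of x xs] x nonneg by auto
  have "y \<le> x" if "y \<in> set xs" for y
  proof -
    have "sqrt y \<le> max_singular_value X"
      unfolding max_singular_value_def using that set_xs
      by (intro Max_ge[OF fin]) (auto simp: singular_values_def B_def[symmetric])
    thus ?thesis using x by simp
  qed
  hence "sum_list xs \<le> real (length xs) * x"
  proof (induction xs)
    case (Cons a xs) thus ?case by (simp add: algebra_simps add_mono)
  qed simp
  thus "(\<Sum>j<n. \<Sum>i<p. (X $$ (i, j))\<^sup>2) \<le> real n * (max_singular_value X)\<^sup>2"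
    unfolding sq tr using len by (simp add: xs_def)
qed

lemma abs_entry_le_max_singular_value:
  fixes X :: "real mat"
  assumes X: "X \<in> carrier_mat p n" and ij: "i < p" "j < n"
  shows "\<bar>X $$ (i, j)\<bar> \<le> sqrt (real n) * max_singular_value X"
proof -
  have n: "n \<ge> 1" using ij by simp
  have "(X $$ (i, j))\<^sup>2 \<le> (\<Sum>i<p. (X $$ (i, j))\<^sup>2)"
    using ij by (intro member_le_sum) auto
  also have "\<dots> \<le> (\<Sum>j<n. \<Sum>i<p. (X $$ (i, j))\<^sup>2)"
    using ij by (intro member_le_sum[of _ _ "\<lambda>j. \<Sum>i<p. (X $$ (i, j))\<^sup>2"]) (auto intro: sum_nonneg)
  also have "\<dots> \<le> (sqrt (real n) * max_singular_value X)\<^sup>2"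
    using sum_sq_le_max_singular_value[OF X n] by (simp add: power_mult_distrib)
  finally show ?thesis
    using max_singular_value_nonneg[OF X n] by (intro power2_le_imp_le[of "\<bar>_\<bar>"]) auto
qed

text \<open>The estimate goes through entries: an entry of \<open>X * Y\<close> is a sum of
  \<open>n\<close> products, each at most \<open>n\<close> times the product of the norms, which
  gives the factor \<open>n ^ 2\<close> in \<open>c\<close>; an \<open>n\<close> by \<open>n\<close>
  matrix with entries bounded by \<open>c\<close> has Frobenius norm at most \<open>n * c\<close>.
  Such a constant does not affect the convergence of \<open>k\<close>-th roots.\<close>

lemma max_singular_value_mult_le:
  fixes X Y :: "real mat"
  assumes X: "X \<in> carrier_mat n n" and Y: "Y \<in> carrier_mat n n" and n: "n \<ge> 1"
  shows "max_singular_value (X * Y) \<le> real n ^ 3 * (max_singular_value X * max_singular_value Y)"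
proof -
  define c where "c = real n ^ 2 * (max_singular_value X * max_singular_value Y)"
  have XY: "X * Y \<in> carrier_mat n n" using X Y by simp
  have nn: "0 \<le> max_singular_value X" "0 \<le> max_singular_value Y"
    using max_singular_value_nonneg X Y n by auto
  have c: "0 \<le> c" using nn by (simp add: c_def)
  have entry: "\<bar>(X * Y) $$ (i, j)\<bar> \<le> c" if "i < n" "j < n" for i j
  proof -
    have "\<bar>(X * Y) $$ (i, j)\<bar> \<le> (\<Sum>k<n. \<bar>X $$ (i, k)\<bar> * \<bar>Y $$ (k, j)\<bar>)"
      unfolding index_mult_mat_sum[OF X Y that] using sum_abs by (simp add: abs_mult[symmetric])
    also have "\<dots> \<le> (\<Sum>k<n. (sqrt (real n) * max_singular_value X) * (sqrt (real n) * max_singular_value Y))"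
    proof (rule sum_mono)
      fix k assume "k \<in> {..<n}"
      hence k: "k < n" by simp
      show "\<bar>X $$ (i, k)\<bar> * \<bar>Y $$ (k, j)\<bar> \<le>
          (sqrt (real n) * max_singular_value X) * (sqrt (real n) * max_singular_value Y)"
        by (rule mult_mono[OF abs_entry_le_max_singular_value[OF X that(1) k]
            abs_entry_le_max_singular_value[OF Y k that(2)]]) (simp_all add: nn)
    qed
    also have "\<dots> = c" using n by (simp add: c_def power2_eq_square)
    finally show ?thesis .
  qed
  have entry_sq: "((X * Y) $$ (i, j))\<^sup>2 \<le> c\<^sup>2" if "i < n" "j < n" for i j
    using power_mono[OF entry[OF that], of 2] by simp
  have "(\<Sum>j<n. \<Sum>i<n. ((X * Y) $$ (i, j))\<^sup>2) \<le> (\<Sum>j<n. \<Sum>i<n. c\<^sup>2)"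
    by (intro sum_mono entry_sq) simp_all
  also have "\<dots> = real n * (real n * c\<^sup>2)" by simp
  also have "\<dots> = (real n * c)\<^sup>2" by (simp only: power_mult_distrib) (simp add: power2_eq_square)
  finally have "(max_singular_value (X * Y))\<^sup>2 \<le> (real n * c)\<^sup>2"
    by (rule order.trans[OF max_singular_value_sq_le[OF XY n]])
  hence "max_singular_value (X * Y) \<le> real n * c"
    by (rule power2_le_imp_le) (simp add: c)
  also have "real n * c = real n ^ 3 * (max_singular_value X * max_singular_value Y)"
    by (simp add: c_def power2_eq_square power3_eq_cube)
  finally show ?thesis .
qed

section \<open>Roots of submultiplicative sequences\<close>

text \<open>Fekete's lemma in multiplicative form.\<close>

lemma submultiplicative_root_convergent:
  fixes b :: "nat \<Rightarrow> real"
  assumes nonneg: "\<And>k. 0 \<le> b k" and sub: "\<And>j k. b (j + k) \<le> b j * b k"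
  shows "convergent (\<lambda>k. root k (b k))"
proof -
  \<comment> \<open>The limit is the infimum of the roots, so the lower estimate is immediate and
    only the upper one needs work.\<close>
  define L where "L = (INF k\<in>{1..}. root k (b k))"
  have bdd: "bdd_below ((\<lambda>k. root k (b k)) ` {1..})"
    using nonneg by (intro bdd_belowI[of _ 0]) auto
  have lower: "L \<le> root k (b k)" if "k \<ge> 1" for k
    unfolding L_def using that by (intro cINF_lower[OF bdd]) auto
  have L0: "L \<ge> 0" unfolding L_def using nonneg by (intro cINF_greatest) auto
  have "(\<lambda>k. root k (b k)) \<longlonglongrightarrow> L"
  proof (rule order_tendstoI)
    fix a assume "a < L"
    thus "eventually (\<lambda>k. a < root k (b k)) sequentially"
      using lower by (intro eventually_sequentiallyI[of 1]) (meson less_le_trans)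
  next
    fix a assume "L < a"
    then obtain x where x: "L < x" "x < a" using dense by blast
    hence x0: "x > 0" using L0 by simp
    \<comment> \<open>A block length whose root is already below \<open>x\<close>; long indices are
      cut into blocks of this length.\<close>
    obtain p where p: "p \<ge> 1" "root p (b p) < x"
      using x(1) unfolding L_def by (subst (asm) cINF_less_iff[OF _ bdd]) auto
    have bp: "b p \<le> x ^ p"
    proof -
      have "b p = root p (b p) ^ p" using p nonneg by simp
      also have "\<dots> \<le> x ^ p" using p nonneg by (intro power_mono) auto
      finally show ?thesis .
    qed
    \<comment> \<open>\<open>D\<close> dominates the contribution of every remainder modulo
      \<open>p\<close>. The summand 1 keeps it positive even if all these terms vanish, so that
      \<open>root k D\<close> tends to 1.\<close>
    define D where "D = 1 + (\<Sum>s<p. b s / x ^ s)"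
    have D: "D > 0" unfolding D_def using nonneg x0 by (intro add_pos_nonneg sum_nonneg) auto
    have bq: "b (q * p + s) \<le> x ^ (q * p) * b s" for q s
    proof (induction q)
      case (Suc q)
      have "b (Suc q * p + s) \<le> b p * b (q * p + s)" using sub[of p "q * p + s"] by (simp add: add_ac)
      also have "\<dots> \<le> x ^ p * (x ^ (q * p) * b s)"
        using bp Suc nonneg x0 by (intro mult_mono) auto
      finally show ?case by (simp add: power_add mult_ac)
    qed simp
    have bn: "b k \<le> D * x ^ k" for k
    proof -
      have "b k \<le> x ^ (k div p * p) * b (k mod p)" using bq[of "k div p" "k mod p"] by simp
      also have "b (k mod p) = (b (k mod p) / x ^ (k mod p)) * x ^ (k mod p)" using x0 by simp
      also have "b (k mod p) / x ^ (k mod p) \<le> (\<Sum>s<p. b s / x ^ s)"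
        using p nonneg x0 by (intro member_le_sum[of _ _ "\<lambda>s. b s / x ^ s"]) auto
      also have "\<dots> \<le> D" by (simp add: D_def)
      also have "x ^ (k div p * p) * (D * x ^ (k mod p)) = D * x ^ (k div p * p + k mod p)"
        unfolding power_add by (simp only: mult_ac)
      finally show ?thesis using x0 by (simp add: mult_mono)
    qed
    have "(\<lambda>k. root k D * x) \<longlonglongrightarrow> 1 * x"
      by (intro tendsto_intros LIMSEQ_root_const D)
    hence "eventually (\<lambda>k. root k D * x < a) sequentially"
      using x by (intro order_tendstoD(2)) auto
    moreover have "eventually (\<lambda>k. root k (b k) \<le> root k D * x) sequentially"
    proof (rule eventually_sequentiallyI[of 1])
      fix k :: nat assume k: "1 \<le> k"
      have "root k (b k) \<le> root k (D * x ^ k)" using bn k by simp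
      also have "\<dots> = root k D * x" using k x0 by (simp add: real_root_mult real_root_power_cancel)
      finally show "root k (b k) \<le> root k D * x" .
    qed
    ultimately show "eventually (\<lambda>k. root k (b k) < a) sequentially"
      by eventually_elim simp
  qed
  thus ?thesis by (auto simp: convergent_def)
qed

text \<open>The rescaled sequence \<open>C * a k\<close> is submultiplicative, and the factor
  \<open>root k C\<close> tends to 1, so it can be divided out afterwards.\<close>

lemma submultiplicative_upto_const_root_convergent:
  fixes a :: "nat \<Rightarrow> real"
  assumes nonneg: "\<And>k. 0 \<le> a k" and sub: "\<And>j k. a (j + k) \<le> C * (a j * a k)" and C: "C > 0"
  shows "convergent (\<lambda>k. root k (a k))"
proof -
  have "convergent (\<lambda>k. root k (C * a k))"
  proof (rule submultiplicative_root_convergent)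
    show "C * a (j + k) \<le> (C * a j) * (C * a k)" for j k
      using mult_left_mono[OF sub[of j k], of C] C by (simp add: mult_ac)
  qed (use nonneg C in auto)
  then obtain l where "(\<lambda>k. root k (C * a k)) \<longlonglongrightarrow> l" by (auto simp: convergent_def)
  hence "(\<lambda>k. root k (C * a k) / root k C) \<longlonglongrightarrow> l / 1"
    by (intro tendsto_divide LIMSEQ_root_const C) auto
  moreover have "eventually (\<lambda>k. root k (C * a k) / root k C = root k (a k)) sequentially"
    using C by (intro eventually_sequentiallyI[of 1]) (auto simp: real_root_mult)
  ultimately have "(\<lambda>k. root k (a k)) \<longlonglongrightarrow> l / 1" by (rule Lim_transform_eventually)
  thus ?thesis by (auto simp: convergent_def)
qed

section \<open>Words, their products, and convergence to the 1-radius\<close>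

lemma finite_index_words: "finite (index_words N k)"
  unfolding index_words_def by (rule finite_subset[OF _ finite_lists_length_eq[of "{1..N}" k]]) auto

lemma sum_index_words_0: "sum f (index_words N 0) = f []"
proof -
  have "index_words N 0 = {[]}" unfolding index_words_def by auto
  thus ?thesis by simp
qed

lemma sum_index_words_add:
  "sum f (index_words N (j + k)) = (\<Sum>u\<in>index_words N j. \<Sum>w\<in>index_words N k. f (u @ w))"
proof -
  have "sum f (index_words N (j + k)) = (\<Sum>(u, w)\<in>index_words N j \<times> index_words N k. f (u @ w))"
    by (rule sum.reindex_bij_witness[of _ "\<lambda>(u, w). u @ w" "\<lambda>w. (take j w, drop j w)"])
      (auto simp: index_words_def dest: in_set_takeD in_set_dropD)
  thus ?thesis by (simp add: sum.cartesian_product)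
qed

text \<open>The head is split off because it is the rightmost factor of \<open>word_product\<close>,
  the one that acts first on an eigenvector.\<close>

lemma sum_index_words_Suc:
  "sum f (index_words N (Suc k)) = (\<Sum>w\<in>index_words N k. \<Sum>i\<in>{1..N}. f (i # w))"
proof -
  have "sum f (index_words N (Suc k)) = (\<Sum>(w, i)\<in>index_words N k \<times> {1..N}. f (i # w))"
    by (rule sum.reindex_bij_witness[of _ "\<lambda>(w, i). i # w" "\<lambda>w. (tl w, hd w)"])
      (auto simp: index_words_def length_Suc_conv)
  thus ?thesis by (simp add: sum.cartesian_product)
qed

lemma word_product_carrier:
  assumes "\<And>i. i \<in> {1..N} \<Longrightarrow> A i \<in> carrier_mat d d" "set w \<subseteq> {1..N}"
  shows "word_product d A w \<in> carrier_mat d d"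
  using assms(2) by (induction w) (use assms(1) in \<open>auto intro!: mult_carrier_mat\<close>)

lemma word_product_append:
  assumes A: "\<And>i. i \<in> {1..N} \<Longrightarrow> A i \<in> carrier_mat d d" and "set u \<subseteq> {1..N}" "set w \<subseteq> {1..N}"
  shows "word_product d A (u @ w) = word_product d A w * word_product d A u"
  using assms(2)
proof (induction u)
  case Nil
  show ?case using word_product_carrier[of N A d w] A assms(3) by simp
next
  case (Cons i u)
  have "word_product d A w \<in> carrier_mat d d" "word_product d A u \<in> carrier_mat d d" "A i \<in> carrier_mat d d"
    using Cons.prems A assms(3) by (auto intro!: word_product_carrier[of N])
  thus ?case using Cons by (simp add: assoc_mult_mat[of _ d d _ d _ d])
qed

text \<open>\<open>one_radius\<close> is a \<open>lim\<close>, which carries information only once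
  convergence is known. Words of length \<open>j + k\<close> are concatenations, so the word sums
  are submultiplicative up to \<open>d ^ 3\<close>, and the normalisation by \<open>N ^ k\<close>
  respects this.\<close>

lemma one_radius_tendsto:
  fixes A :: "nat \<Rightarrow> real mat"
  assumes N: "N \<ge> 1" and d: "d \<ge> 1" and A: "\<And>i. i \<in> {1..N} \<Longrightarrow> A i \<in> carrier_mat d d"
  shows "(\<lambda>k. root k (1 / real N ^ k * (\<Sum>w\<in>index_words N k. max_singular_value (word_product d A w))))
    \<longlonglongrightarrow> one_radius N d A"
proof -
  define s where "s k = (\<Sum>w\<in>index_words N k. max_singular_value (word_product d A w))" for k
  have carrier: "word_product d A w \<in> carrier_mat d d" if "w \<in> index_words N k" for w k
    using that by (intro word_product_carrier[of N] A) (auto simp: index_words_def)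
  have s_nonneg: "0 \<le> s k" for k
    unfolding s_def using carrier by (intro sum_nonneg max_singular_value_nonneg[OF _ d])
  have s_sub: "s (j + k) \<le> real d ^ 3 * (s j * s k)" for j k
  proof -
    have "s (j + k) = (\<Sum>u\<in>index_words N j. \<Sum>w\<in>index_words N k.
        max_singular_value (word_product d A w * word_product d A u))"
      unfolding s_def sum_index_words_add
      by (intro sum.cong refl, subst word_product_append[of N]) (auto simp: index_words_def A)
    also have "\<dots> \<le> (\<Sum>u\<in>index_words N j. \<Sum>w\<in>index_words N k.
        real d ^ 3 * (max_singular_value (word_product d A w) * max_singular_value (word_product d A u)))"
      by (intro sum_mono max_singular_value_mult_le carrier d)
    also have "\<dots> = real d ^ 3 * (s j * s k)"
      unfolding s_def sum_distrib_left[symmetric] sum_distrib_right[symmetric] by (simp add: mult_ac)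
    finally show ?thesis .
  qed
  have "convergent (\<lambda>k. root k (1 / real N ^ k * s k))"
  proof (rule submultiplicative_upto_const_root_convergent)
    show "1 / real N ^ (j + k) * s (j + k) \<le> real d ^ 3 * ((1 / real N ^ j * s j) * (1 / real N ^ k * s k))" for j k
      using s_sub[of j k] N by (simp add: power_add field_simps)
  qed (use s_nonneg d in auto)
  thus ?thesis unfolding one_radius_def s_def by (simp add: convergent_LIMSEQ_iff)
qed

section \<open>Kronecker products and sums of matrices\<close>

text \<open>Quotient and remainder modulo \<open>n\<close> identify a composite Kronecker index with
  a pair of indices.\<close>

lemma sum_lessThan_mult_split:
  fixes f :: "nat \<Rightarrow> nat \<Rightarrow> 'a :: comm_monoid_add"
  shows "(\<Sum>k<m * n. f (k div n) (k mod n)) = (\<Sum>i<m. \<Sum>j<n. f i j)"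
proof -
  have "(\<Sum>k<m * n. f (k div n) (k mod n)) = (\<Sum>(i, j)\<in>{..<m} \<times> {..<n}. f i j)"
  proof (rule sum.reindex_bij_witness[of _ "\<lambda>(i, j). i * n + j" "\<lambda>k. (k div n, k mod n)"])
    show "(case ij of (i, j) \<Rightarrow> i * n + j) \<in> {..<m * n}" if mem: "ij \<in> {..<m} \<times> {..<n}" for ij
    proof -
      obtain i j where ij: "ij = (i, j)" "i < m" "j < n" using mem by (cases ij) auto
      have "i * n + j < Suc i * n" using ij by simp
      also have "\<dots> \<le> m * n" using ij by (intro mult_le_mono1) simp
      finally show ?thesis using ij by simp
    qed
    show "(k div n, k mod n) \<in> {..<m} \<times> {..<n}" if "k \<in> {..<m * n}" for k
      using that by (cases "n = 0") (auto simp: less_mult_imp_div_less)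
  qed auto
  thus ?thesis by (simp add: sum.cartesian_product)
qed

lemma index_kronecker:
  assumes "W \<in> carrier_mat m m" "A \<in> carrier_mat n n" "r < m * n" "c < m * n"
  shows "(W \<otimes>\<^sub>K A) $$ (r, c) = W $$ (r div n, c div n) * A $$ (r mod n, c mod n)"
  using assms by (auto simp: kronecker_def)

lemma kronecker_carrier:
  "W \<in> carrier_mat m m \<Longrightarrow> A \<in> carrier_mat n n \<Longrightarrow> W \<otimes>\<^sub>K A \<in> carrier_mat (m * n) (m * n)"
  by (auto simp: kronecker_def)

text \<open>The mixed-product rule: the inner sum over composite indices becomes a double sum, and
  by commutativity of the scalars it factors into an entry of \<open>W * W'\<close> times an entry
  of \<open>A * A'\<close>.\<close>

lemma kronecker_mult:
  fixes W W' A A' :: "'a :: comm_semiring_0 mat"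
  assumes W: "W \<in> carrier_mat m m" "W' \<in> carrier_mat m m"
    and A: "A \<in> carrier_mat n n" "A' \<in> carrier_mat n n"
  shows "(W * W') \<otimes>\<^sub>K (A * A') = (W \<otimes>\<^sub>K A) * (W' \<otimes>\<^sub>K A')"
proof (rule eq_matI)
  have cW: "W * W' \<in> carrier_mat m m" and cA: "A * A' \<in> carrier_mat n n" using W A by auto
  note k1 = kronecker_carrier[OF W(1) A(1)] and k2 = kronecker_carrier[OF W(2) A(2)]
  show "dim_row ((W * W') \<otimes>\<^sub>K (A * A')) = dim_row ((W \<otimes>\<^sub>K A) * (W' \<otimes>\<^sub>K A'))"
    "dim_col ((W * W') \<otimes>\<^sub>K (A * A')) = dim_col ((W \<otimes>\<^sub>K A) * (W' \<otimes>\<^sub>K A'))"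
    using kronecker_carrier[OF cW cA] k1 k2 by auto
  fix r c assume "r < dim_row ((W \<otimes>\<^sub>K A) * (W' \<otimes>\<^sub>K A'))" "c < dim_col ((W \<otimes>\<^sub>K A) * (W' \<otimes>\<^sub>K A'))"
  hence rc: "r < m * n" "c < m * n" using k1 k2 by auto
  hence n: "n > 0" by (cases n) auto
  have dm: "r div n < m" "c div n < m" "r mod n < n" "c mod n < n"
    using rc n by (auto simp: less_mult_imp_div_less)
  have "((W \<otimes>\<^sub>K A) * (W' \<otimes>\<^sub>K A')) $$ (r, c) = (\<Sum>k<m * n. (W \<otimes>\<^sub>K A) $$ (r, k) * (W' \<otimes>\<^sub>K A') $$ (k, c))"
    by (rule index_mult_mat_sum[OF k1 k2 rc])
  also have "\<dots> = (\<Sum>k<m * n. (W $$ (r div n, k div n) * A $$ (r mod n, k mod n)) *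
      (W' $$ (k div n, c div n) * A' $$ (k mod n, c mod n)))"
    using rc by (intro sum.cong) (auto simp: index_kronecker[OF W(1) A(1)] index_kronecker[OF W(2) A(2)])
  also have "\<dots> = (\<Sum>i<m. \<Sum>j<n. (W $$ (r div n, i) * A $$ (r mod n, j)) *
      (W' $$ (i, c div n) * A' $$ (j, c mod n)))"
    by (rule sum_lessThan_mult_split)
  also have "\<dots> = (W * W') $$ (r div n, c div n) * (A * A') $$ (r mod n, c mod n)"
    unfolding index_mult_mat_sum[OF W dm(1,2)] index_mult_mat_sum[OF A dm(3,4)] sum_product
    by (simp add: mult_ac)
  also have "\<dots> = ((W * W') \<otimes>\<^sub>K (A * A')) $$ (r, c)"
    by (rule index_kronecker[OF cW cA rc, symmetric])
  finally show "((W * W') \<otimes>\<^sub>K (A * A')) $$ (r, c) = ((W \<otimes>\<^sub>K A) * (W' \<otimes>\<^sub>K A')) $$ (r, c)" ..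
qed

lemma finsum_mat_carrier:
  fixes f :: "'i \<Rightarrow> 'a :: comm_ring_1 mat"
  assumes "\<And>i. i \<in> I \<Longrightarrow> f i \<in> carrier_mat a b"
  shows "finsum (module_mat TYPE('a) a b) f I \<in> carrier_mat a b"
proof -
  interpret M: abelian_group "module_mat TYPE('a) a b" by (rule abelian_group_mat)
  show ?thesis using M.finsum_closed[of f I] assms by (auto simp: module_mat_simps)
qed

text \<open>Translates the sum in the structure \<open>module_mat\<close>, used in
  \<open>kronecker_mean\<close>, into ordinary sums of entries, on which the eigenvector computation
  is carried out.\<close>

lemma index_finsum_mat:
  fixes f :: "'i \<Rightarrow> 'a :: comm_ring_1 mat"
  assumes "finite I" "\<And>i. i \<in> I \<Longrightarrow> f i \<in> carrier_mat a b" "r < a" "c < b"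
  shows "finsum (module_mat TYPE('a) a b) f I $$ (r, c) = (\<Sum>i\<in>I. f i $$ (r, c))"
  using assms(1,2)
proof (induction I rule: finite_induct)
  interpret M: abelian_group "module_mat TYPE('a) a b" by (rule abelian_group_mat)
  case empty
  show ?case using assms(3,4) by (simp add: M.finsum_empty module_mat_simps)
next
  interpret M: abelian_group "module_mat TYPE('a) a b" by (rule abelian_group_mat)
  case (insert i I)
  have "finsum (module_mat TYPE('a) a b) f I \<in> carrier_mat a b"
    using insert.prems by (intro finsum_mat_carrier) auto
  thus ?case using insert assms(3,4) by (subst M.finsum_insert) (auto simp: module_mat_simps)
qed

lemma kronecker_one: "1\<^sub>m m \<otimes>\<^sub>K 1\<^sub>m n = (1\<^sub>m (m * n) :: 'a :: semiring_1 mat)"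
proof (rule eq_matI)
  fix r c assume "r < dim_row (1\<^sub>m (m * n) :: 'a mat)" "c < dim_col (1\<^sub>m (m * n) :: 'a mat)"
  hence rc: "r < m * n" "c < m * n" by auto
  hence n: "n > 0" by (cases n) auto
  have "r = c \<longleftrightarrow> r div n = c div n \<and> r mod n = c mod n" by (metis div_mult_mod_eq)
  thus "(1\<^sub>m m \<otimes>\<^sub>K 1\<^sub>m n) $$ (r, c) = (1\<^sub>m (m * n) :: 'a mat) $$ (r, c)"
    using rc n by (auto simp: kronecker_def less_mult_imp_div_less)
qed (auto simp: kronecker_def)

lemma word_product_kronecker:
  assumes W: "\<And>i. i \<in> {1..N} \<Longrightarrow> W i \<in> carrier_mat m m"
    and A: "\<And>i. i \<in> {1..N} \<Longrightarrow> A i \<in> carrier_mat n n" and "set w \<subseteq> {1..N}"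
  shows "word_product (m * n) (\<lambda>i. W i \<otimes>\<^sub>K A i) w = word_product m W w \<otimes>\<^sub>K word_product n A w"
  using assms(3)
proof (induction w)
  case (Cons i w)
  hence i: "i \<in> {1..N}" and w: "set w \<subseteq> {1..N}" by auto
  have "word_product m W (i # w) \<otimes>\<^sub>K word_product n A (i # w) =
      (word_product m W w \<otimes>\<^sub>K word_product n A w) * (W i \<otimes>\<^sub>K A i)"
    using kronecker_mult[OF word_product_carrier[OF W w] W[OF i] word_product_carrier[OF A w] A[OF i]] by simp
  thus ?case using Cons.IH w by simp
qed (simp add: kronecker_one)

section \<open>Powers of an eigenvalue as sums over words\<close>

text \<open>The sum of all word products of length \<open>k\<close> is the \<open>k\<close>-th power
  of the sum of the \<open>T i\<close>, and \<open>ev\<close> says that \<open>v\<close> is an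
  eigenvector of that sum for \<open>\<mu>\<close>. In the induction the head letter acts on
  \<open>v\<close> first, so summing over it yields one factor \<open>\<mu>\<close>.\<close>

lemma sum_word_product_eigenvector:
  fixes T :: "nat \<Rightarrow> real mat" and v :: "nat \<Rightarrow> complex"
  assumes T: "\<And>i. i \<in> {1..N} \<Longrightarrow> T i \<in> carrier_mat d d"
    and ev: "\<And>r. r < d \<Longrightarrow> (\<Sum>i\<in>{1..N}. \<Sum>c<d. of_real (T i $$ (r, c)) * v c) = \<mu> * v r"
    and "r < d"
  shows "(\<Sum>w\<in>index_words N k. \<Sum>c<d. of_real (word_product d T w $$ (r, c)) * v c) = \<mu> ^ k * v r"
proof (induction k)
  case 0
  have "(\<Sum>c<d. of_real (1\<^sub>m d $$ (r, c)) * v c) = (\<Sum>c<d. if c = r then v c else 0)"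
    using \<open>r < d\<close> by (intro sum.cong) auto
  thus ?case using \<open>r < d\<close> by (simp add: sum_index_words_0)
next
  case (Suc k)
  have "(\<Sum>i\<in>{1..N}. \<Sum>c<d. of_real (word_product d T (i # w) $$ (r, c)) * v c) =
      \<mu> * (\<Sum>c<d. of_real (word_product d T w $$ (r, c)) * v c)" if "w \<in> index_words N k" for w
  proof -
    let ?P = "word_product d T w"
    have P: "?P \<in> carrier_mat d d"
      using that by (intro word_product_carrier[of N] T) (auto simp: index_words_def)
    have "(\<Sum>i\<in>{1..N}. \<Sum>c<d. of_real (word_product d T (i # w) $$ (r, c)) * v c) =
        (\<Sum>i\<in>{1..N}. \<Sum>c<d. \<Sum>b<d. of_real (?P $$ (r, b)) * (of_real (T i $$ (b, c)) * v c))"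
      using \<open>r < d\<close> by (intro sum.cong)
        (auto simp: index_mult_mat_sum[OF P T] sum_distrib_left sum_distrib_right mult_ac
          simp del: index_mult_mat)
    also have "\<dots> = (\<Sum>i\<in>{1..N}. \<Sum>b<d. \<Sum>c<d. of_real (?P $$ (r, b)) * (of_real (T i $$ (b, c)) * v c))"
      by (intro sum.cong refl sum.swap)
    also have "\<dots> = (\<Sum>b<d. \<Sum>i\<in>{1..N}. \<Sum>c<d. of_real (?P $$ (r, b)) * (of_real (T i $$ (b, c)) * v c))"
      by (rule sum.swap)
    also have "\<dots> = (\<Sum>b<d. of_real (?P $$ (r, b)) * (\<mu> * v b))"
      unfolding sum_distrib_left[symmetric] using ev by (intro sum.cong) auto
    finally show ?thesis by (simp add: sum_distrib_left mult_ac)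
  qed
  thus ?case using Suc.IH by (simp only: sum_index_words_Suc) (simp add: sum_distrib_left[symmetric])
qed

text \<open>An entry of a Kronecker product is an entry of the \<open>W\<close> word times an entry
  of the \<open>A\<close> word, each bounded by its norm. Since \<open>\<beta>\<close> is uniform
  over the words, it leaves the sum, and what remains is the word sum occurring in the
  1-radius.\<close>

lemma norm_word_sum_le:
  fixes W A :: "nat \<Rightarrow> real mat" and v :: "nat \<Rightarrow> complex"
  assumes m: "m \<ge> 1" and n: "n \<ge> 1"
    and W: "\<And>i. i \<in> {1..N} \<Longrightarrow> W i \<in> carrier_mat m m"
    and A: "\<And>i. i \<in> {1..N} \<Longrightarrow> A i \<in> carrier_mat n n"
    and r: "r < m * n"
    and bound: "\<And>w. w \<in> index_words N k \<Longrightarrow> max_singular_value (word_product m W w) \<le> \<beta>"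
  shows "cmod (\<Sum>w\<in>index_words N k. \<Sum>c<m * n.
      of_real (word_product (m * n) (\<lambda>i. W i \<otimes>\<^sub>K A i) w $$ (r, c)) * v c)
    \<le> sqrt (real m) * sqrt (real n) * (\<Sum>c<m * n. cmod (v c)) *
      (\<beta> * (\<Sum>w\<in>index_words N k. max_singular_value (word_product n A w)))"
proof -
  have "cmod (\<Sum>w\<in>index_words N k. \<Sum>c<m * n.
      of_real (word_product (m * n) (\<lambda>i. W i \<otimes>\<^sub>K A i) w $$ (r, c)) * v c)
    \<le> (\<Sum>w\<in>index_words N k. \<Sum>c<m * n.
      \<bar>word_product (m * n) (\<lambda>i. W i \<otimes>\<^sub>K A i) w $$ (r, c)\<bar> * cmod (v c))"
    by (intro sum_norm_le order.trans[OF norm_sum] sum_mono) (simp add: norm_mult)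
  also have "\<dots> \<le> (\<Sum>w\<in>index_words N k. \<Sum>c<m * n.
      ((sqrt (real m) * \<beta>) * (sqrt (real n) * max_singular_value (word_product n A w))) * cmod (v c))"
  proof (intro sum_mono mult_right_mono)
    fix w c assume w: "w \<in> index_words N k" and "c \<in> {..<m * n}"
    hence c: "c < m * n" and w': "set w \<subseteq> {1..N}" by (auto simp: index_words_def)
    have cW: "word_product m W w \<in> carrier_mat m m" and cA: "word_product n A w \<in> carrier_mat n n"
      using word_product_carrier[of N] W A w' by blast+
    have dm: "r div n < m" "c div n < m" "r mod n < n" "c mod n < n"
      using r c n by (auto simp: less_mult_imp_div_less)
    have "\<bar>word_product (m * n) (\<lambda>i. W i \<otimes>\<^sub>K A i) w $$ (r, c)\<bar> =
      \<bar>word_product m W w $$ (r div n, c div n)\<bar> * \<bar>word_product n A w $$ (r mod n, c mod n)\<bar>"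
      by (subst word_product_kronecker[OF W A w']) (simp_all only: index_kronecker[OF cW cA r c] abs_mult)
    also have "\<dots> \<le> (sqrt (real m) * \<beta>) * (sqrt (real n) * max_singular_value (word_product n A w))"
    proof (rule mult_mono)
      show "\<bar>word_product m W w $$ (r div n, c div n)\<bar> \<le> sqrt (real m) * \<beta>"
        using abs_entry_le_max_singular_value[OF cW dm(1,2)] bound[OF w]
        by (meson mult_left_mono order.trans real_sqrt_ge_zero of_nat_0_le_iff)
      show "\<bar>word_product n A w $$ (r mod n, c mod n)\<bar> \<le> sqrt (real n) * max_singular_value (word_product n A w)"
        by (rule abs_entry_le_max_singular_value[OF cA dm(3,4)])
      show "0 \<le> sqrt (real m) * \<beta>"
        using max_singular_value_nonneg[OF cW m] bound[OF w] by simp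
    qed simp
    finally show "\<bar>word_product (m * n) (\<lambda>i. W i \<otimes>\<^sub>K A i) w $$ (r, c)\<bar>
      \<le> (sqrt (real m) * \<beta>) * (sqrt (real n) * max_singular_value (word_product n A w))" .
  qed simp
  also have "\<dots> = sqrt (real m) * sqrt (real n) * (\<Sum>c<m * n. cmod (v c)) *
      (\<beta> * (\<Sum>w\<in>index_words N k. max_singular_value (word_product n A w)))"
    unfolding sum_distrib_left[symmetric] sum_distrib_right[symmetric] by (simp add: mult_ac)
  finally show ?thesis .
qed

text \<open>A limsup strictly below \<open>x\<close> puts the maximum of the roots below
  \<open>x\<close> for all large \<open>k\<close>, hence every single root.\<close>

lemma eventually_max_singular_value_le_power:
  assumes N: "N \<ge> 1" and m: "m \<ge> 1" and W: "\<And>i. i \<in> {1..N} \<Longrightarrow> W i \<in> carrier_mat m m"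
    and jsr: "joint_spectral_radius N m W < ereal x"
  shows "eventually (\<lambda>k. \<forall>w\<in>index_words N k. max_singular_value (word_product m W w) \<le> x ^ k) sequentially"
proof -
  have "eventually (\<lambda>k. ereal (Max ((\<lambda>w. root k (max_singular_value (word_product m W w))) ` index_words N k)) < ereal x) sequentially"
    using jsr unfolding joint_spectral_radius_def by (rule Limsup_lessD)
  \<comment> \<open>Since \<open>root 0\<close> is constantly 0, cancelling the root against the
    power uses a positive \<open>k\<close>.\<close>
  moreover have "eventually (\<lambda>k. k \<ge> (1 :: nat)) sequentially" by (rule eventually_ge_at_top)
  ultimately show ?thesis
  proof eventually_elim
    case (elim k)
    show ?case
    proof
      fix w assume w: "w \<in> index_words N k"
      let ?s = "max_singular_value (word_product m W w)"
      have "word_product m W w \<in> carrier_mat m m"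
        using w by (intro word_product_carrier[of N] W) (auto simp: index_words_def)
      hence s: "0 \<le> ?s" by (rule max_singular_value_nonneg[OF _ m])
      have "root k ?s \<le> Max ((\<lambda>w. root k (max_singular_value (word_product m W w))) ` index_words N k)"
        using w by (intro Max_ge finite_imageI finite_index_words) auto
      hence "root k ?s \<le> x" using elim by simp
      hence "root k ?s ^ k \<le> x ^ k" using s elim by (intro power_mono) auto
      thus "?s \<le> x ^ k" using s elim by simp
    qed
  qed
qed

section \<open>Passage to the limit\<close>

theorem theorem3:
  fixes N n m :: nat and A W :: "nat \<Rightarrow> real mat"
  assumes "N \<ge> 1" and "n \<ge> 1" and "m \<ge> 1"
    and "\<And>i. i \<in> {1..N} \<Longrightarrow> A i \<in> carrier_mat n n"
    and "\<And>i. i \<in> {1..N} \<Longrightarrow> W i \<in> carrier_mat m m"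
    and "joint_spectral_radius N m W = 1"
  shows "kronecker_radius N m n W A \<le> one_radius N n A"
proof -
  note A = assms(4) and W = assms(5)
  define d where "d = m * n"
  define T where "T = (\<lambda>i. W i \<otimes>\<^sub>K A i)"
  define M where "M = kronecker_mean N m n W A"
  define a where "a k = (\<Sum>w\<in>index_words N k. max_singular_value (word_product n A w))" for k
  have d: "d > 0" using assms by (simp add: d_def)
  have T: "T i \<in> carrier_mat d d" if "i \<in> {1..N}" for i
    using that unfolding T_def d_def by (intro kronecker_carrier A W)
  have M: "M \<in> carrier_mat d d"
    using finsum_mat_carrier[of "{1..N}" T d d] T
    unfolding M_def kronecker_mean_def d_def[symmetric] T_def by auto
  have index_M: "M $$ (r, c) = (\<Sum>i\<in>{1..N}. T i $$ (r, c)) / real N" if "r < d" "c < d" for r c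
    using index_finsum_mat[of "{1..N}" T d d r c] finsum_mat_carrier[of "{1..N}" T d d] T that
    unfolding M_def kronecker_mean_def d_def[symmetric] T_def by auto
  have CM: "map_mat complex_of_real M \<in> carrier_mat d d" using M by auto
  from spectral_radius_mem_max(1)[OF CM d] obtain z where
    z: "z \<in> spectrum (map_mat complex_of_real M)" and rad: "kronecker_radius N m n W A = cmod z"
    by (auto simp: kronecker_radius_def M_def)
  from z obtain v where v: "v \<in> carrier_vec d" "v \<noteq> 0\<^sub>v d"
      "map_mat complex_of_real M *\<^sub>v v = z \<cdot>\<^sub>v v"
    using CM by (auto simp: spectrum_def eigenvalue_def eigenvector_def)
  \<comment> \<open>Clearing the factor \<open>1 / N\<close> makes \<open>v\<close> an eigenvector
    of the plain sum, with eigenvalue \<open>N * z\<close>; the powers of \<open>N\<close> come back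
    later as the normalisation of the word sums.\<close>
  have ev: "(\<Sum>i\<in>{1..N}. \<Sum>c<d. of_real (T i $$ (r, c)) * v $ c) = (of_nat N * z) * v $ r" if "r < d" for r
  proof -
    have "z * v $ r = (map_mat complex_of_real M *\<^sub>v v) $ r" using v that by simp
    also have "\<dots> = (\<Sum>c<d. map_mat complex_of_real M $$ (r, c) * v $ c)"
      using CM v that by (intro index_mult_mat_vec_sum) auto
    also have "\<dots> = (\<Sum>c<d. (\<Sum>i\<in>{1..N}. of_real (T i $$ (r, c)) * v $ c) / of_nat N)"
      using M that by (intro sum.cong) (auto simp: index_M sum_distrib_right)
    also have "\<dots> = (\<Sum>c<d. \<Sum>i\<in>{1..N}. of_real (T i $$ (r, c)) * v $ c) / of_nat N"
      by (simp add: sum_divide_distrib)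
    also have "(\<Sum>c<d. \<Sum>i\<in>{1..N}. of_real (T i $$ (r, c)) * v $ c) =
        (\<Sum>i\<in>{1..N}. \<Sum>c<d. of_real (T i $$ (r, c)) * v $ c)" by (rule sum.swap)
    finally show ?thesis using assms(1) by (simp add: field_simps)
  qed
  \<comment> \<open>One nonzero coordinate is enough: comparing the \<open>r\<close>-th coordinates
    and dividing by \<open>cmod (v $ r)\<close> isolates the power of \<open>z\<close>.\<close>
  from v obtain r where r: "r < d" "v $ r \<noteq> 0" by (metis carrier_vecD eq_vecI index_zero_vec)
  \<comment> \<open>The constant of \<open>norm_word_sum_le\<close> divided by
    \<open>cmod (v $ r)\<close>. It does not depend on \<open>k\<close> and is positive, so its
    \<open>k\<close>-th root tends to 1.\<close>
  define C where "C = sqrt (real m) * sqrt (real n) * (\<Sum>c<d. cmod (v $ c)) / cmod (v $ r)"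
  have "0 < cmod (v $ r)" "cmod (v $ r) \<le> (\<Sum>c<d. cmod (v $ c))"
    using r by (auto intro!: member_le_sum)
  hence "0 < (\<Sum>c<d. cmod (v $ c))" by linarith
  hence C: "C > 0" unfolding C_def using assms(2,3) r by (intro divide_pos_pos mult_pos_pos) auto
  have lim: "(\<lambda>k. root k (1 / real N ^ k * a k)) \<longlonglongrightarrow> one_radius N n A"
    unfolding a_def by (rule one_radius_tendsto[OF assms(1,2) A])
  \<comment> \<open>Joint spectral radius 1 does not bound the \<open>W\<close> products by 1; it
    only bounds them by \<open>x ^ k\<close> eventually, for each \<open>x\<close> above 1. The
    \<open>k\<close>-th root turns this into a factor \<open>x\<close>.\<close>
  have le: "cmod z \<le> x * one_radius N n A" if x: "x > 1" for x
  proof (rule tendsto_lowerbound)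
    show "(\<lambda>k. root k C * (x * root k (1 / real N ^ k * a k))) \<longlonglongrightarrow> x * one_radius N n A"
      using tendsto_mult[OF LIMSEQ_root_const[OF C] tendsto_mult_left[OF lim, of x]] by simp
    have "eventually (\<lambda>k. \<forall>w\<in>index_words N k. max_singular_value (word_product m W w) \<le> x ^ k) sequentially"
      using x assms by (intro eventually_max_singular_value_le_power) auto
    moreover have "eventually (\<lambda>k. k \<ge> (1 :: nat)) sequentially" by (rule eventually_ge_at_top)
    ultimately show "eventually (\<lambda>k. cmod z \<le> root k C * (x * root k (1 / real N ^ k * a k))) sequentially"
    proof eventually_elim
      case (elim k)
      have "real N ^ k * cmod z ^ k * cmod (v $ r) = cmod ((of_nat N * z) ^ k * v $ r)"
        by (simp add: norm_mult norm_power power_mult_distrib)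
      also have "(of_nat N * z) ^ k * v $ r =
          (\<Sum>w\<in>index_words N k. \<Sum>c<d. of_real (word_product d T w $$ (r, c)) * v $ c)"
        by (rule sum_word_product_eigenvector[OF T ev r(1), symmetric])
      also have "cmod \<dots> \<le> sqrt (real m) * sqrt (real n) * (\<Sum>c<d. cmod (v $ c)) * (x ^ k * a k)"
        unfolding d_def T_def a_def
        by (rule norm_word_sum_le[OF assms(3,2) W A]) (use elim r in \<open>auto simp: d_def\<close>)
      finally have "cmod z ^ k \<le> C * (x ^ k * (1 / real N ^ k * a k))"
        using r assms(1) by (simp add: C_def field_simps)
      hence "root k (cmod z ^ k) \<le> root k (C * (x ^ k * (1 / real N ^ k * a k)))"
        using elim by simp
      thus ?case using elim x by (simp only: real_root_mult) (simp add: real_root_power_cancel)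
    qed
  qed simp
  \<comment> \<open>Now \<open>x\<close> decreases to 1; the interval from 1 to 2 serves as the
    right neighbourhood.\<close>
  have "cmod z \<le> 1 * one_radius N n A"
  proof (rule tendsto_lowerbound)
    show "((\<lambda>x. x * one_radius N n A) \<longlongrightarrow> 1 * one_radius N n A) (at_right 1)"
      by (intro tendsto_intros)
    show "eventually (\<lambda>x. cmod z \<le> x * one_radius N n A) (at_right 1)"
      using le by (auto simp: eventually_at_right_field intro!: exI[of _ 2])
  qed simp
  thus ?thesis by (simp add: rad)
qed

end
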